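(* Let $\mu$ be a singular cardinal with $\mathrm{cf}(\mu)=\kappa$, $\mu$ a limit of measurable cardinals. Let $\bar{\lambda}=\langle\lambda_\varepsilon:\varepsilon<\kappa\rangle$ be a sequence of measurable cardinals tending to $\mu$, with $2^{\lambda_\varepsilon}=\lambda_\varepsilon^+$ for every $\varepsilon<\kappa$, and assume $\prod_{\varepsilon<\kappa}\lambda^+_\varepsilon/J^{\mathrm{bd}}_\kappa$ is $\Upsilon$-directed for some cardinal $\Upsilon\in[\mu^{++},2^\mu)$. Then for every sequence $\bar{D}=\langle D_\varepsilon:\varepsilon<\kappa\rangle$ where each $D_\varepsilon$ is a normal uniform ultrafilter on $\lambda_\varepsilon$, the product $\prod_{\varepsilon<\kappa}(D_\varepsilon,\subseteq^* )/J^{\mathrm{bd}}_\kappa$ is $\Upsilon$-directed.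
   Context: $J^{\mathrm{bd}}_\kappa$ is the ideal of bounded subsets of $\kappa$. For $f,g\in\prod_{\varepsilon<\kappa}\lambda^+_\varepsilon$, $f\leq_{J^{\mathrm{bd}}_\kappa}g$ means $\{\varepsilon : f(\varepsilon)>g(\varepsilon)\}$ is bounded in $\kappa$. For $X,Y\subseteq\lambda_\varepsilon$, $X\subseteq^*Y$ means $X\setminus Y$ is bounded in $\lambda_\varepsilon$. In $\prod_{\varepsilon<\kappa}(D_\varepsilon,\subseteq^* )$ (sequences $\bar{C}$ with $C_\varepsilon\in D_\varepsilon$) the order is reverse almost inclusion: $\bar{C}\leq\bar{C}'$ modulo $J^{\mathrm{bd}}_\kappa$ iff $\{\varepsilon<\kappa : C'_\varepsilon\not\subseteq^* C_\varepsilon\}$ is bounded in $\kappa$. A product is $\Upsilon$-directed if every subset of cardinality less than $\Upsilon$ has an upper bound modulo $J^{\mathrm{bd}}_\kappa$. *)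

theory Defs
  imports Main "HOL-Library.FuncSet"
begin

unbundle cardinal_syntax

text \<open>
  A cardinal is a relation \<open>r\<close> with \<open>Card_order r\<close>, i.e. an initial well-order, possibly on its own
  type; the ordinals below it are the elements of \<open>Field r\<close>, ordered by \<open>r\<close>. Cardinals are compared
  up to isomorphism, and across types, by \<open>=o\<close>, \<open>\<le>o\<close>, \<open><o\<close>. The successor cardinal is \<open>cardSuc r\<close>
  and the power of two is \<open>ctwo ^c r\<close>.
\<close>

definition Jbd :: "'a rel \<Rightarrow> 'a set set" where
  "Jbd r = {X. X \<subseteq> Field r \<and> (\<exists>b\<in>Field r. \<forall>x\<in>X. (x, b) \<in> r)}"

definition has_cofinality :: "'a rel \<Rightarrow> 'b rel \<Rightarrow> bool" where
  "has_cofinality r k \<longleftrightarrow> Card_order k \<and>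
     (\<exists>K \<subseteq> Field r. cofinal K r \<and> |K| =o k) \<and>
     (\<forall>K \<subseteq> Field r. cofinal K r \<longrightarrow> k \<le>o |K| )"

definition singular_cardinal :: "'a rel \<Rightarrow> bool" where
  "singular_cardinal r \<longleftrightarrow> Card_order r \<and> cinfinite r \<and> \<not> regularCard r"

definition ultrafilter_on :: "'a set \<Rightarrow> 'a set set \<Rightarrow> bool" where
  "ultrafilter_on S D \<longleftrightarrow>
     D \<subseteq> Pow S \<and> S \<in> D \<and> {} \<notin> D \<and>
     (\<forall>X\<in>D. \<forall>Y\<in>D. X \<inter> Y \<in> D) \<and>
     (\<forall>X\<in>D. \<forall>Y. X \<subseteq> Y \<and> Y \<subseteq> S \<longrightarrow> Y \<in> D) \<and>
     (\<forall>X. X \<subseteq> S \<longrightarrow> X \<in> D \<or> S - X \<in> D)"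

definition complete_ultrafilter :: "'a rel \<Rightarrow> 'a set set \<Rightarrow> bool" where
  "complete_ultrafilter r D \<longleftrightarrow> ultrafilter_on (Field r) D \<and>
     (\<forall>\<X>. \<X> \<subseteq> D \<and> \<X> \<noteq> {} \<and> |\<X>| <o r \<longrightarrow> \<Inter>\<X> \<in> D)"

definition measurable_cardinal :: "'a rel \<Rightarrow> bool" where
  "measurable_cardinal r \<longleftrightarrow> Card_order r \<and> natLeq <o r \<and>
     (\<exists>D. complete_ultrafilter r D \<and> (\<forall>x\<in>Field r. {x} \<notin> D))"

definition diagonal_intersection :: "'a rel \<Rightarrow> ('a \<Rightarrow> 'a set) \<Rightarrow> 'a set" where
  "diagonal_intersection r X = {\<beta>\<in>Field r. \<forall>\<alpha>\<in>underS r \<beta>. \<beta> \<in> X \<alpha>}"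

text \<open>
  Completeness need not be required separately below: in a uniform ultrafilter all final segments
  have measure one, and intersecting one with a diagonal intersection gives closure under
  intersections of fewer than \<open>r\<close> many sets.
\<close>

definition normal_uniform_ultrafilter :: "'a rel \<Rightarrow> 'a set set \<Rightarrow> bool" where
  "normal_uniform_ultrafilter r D \<longleftrightarrow>
     ultrafilter_on (Field r) D \<and>
     (\<forall>X\<in>D. |X| =o r) \<and>
     (\<forall>X. (\<forall>\<alpha>\<in>Field r. X \<alpha> \<in> D) \<longrightarrow> diagonal_intersection r X \<in> D)"

definition almost_subset :: "'a rel \<Rightarrow> 'a set \<Rightarrow> 'a set \<Rightarrow> bool" where
  "almost_subset r X Y \<longleftrightarrow> X - Y \<in> Jbd r"

text \<open>
  Convergence in the order topology: for every cardinal \<open>\<chi> < \<mu>\<close>, all but boundedly many \<open>\<lambda>\<^sub>\<epsilon>\<close> lie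
  in the interval \<open>(\<chi>, \<mu>]\<close>. Every cardinal below \<open>\<mu>\<close> has a copy on the type underlying \<open>\<mu>\<close>,
  so it suffices to let \<open>\<chi>\<close> range over that type; the same applies to limits of measurables.
\<close>

definition tends_to_cardinal :: "'k rel \<Rightarrow> ('k \<Rightarrow> 'a rel) \<Rightarrow> 'm rel \<Rightarrow> bool" where
  "tends_to_cardinal \<kappa> lam \<mu> \<longleftrightarrow>
     (\<forall>\<chi> :: 'm rel. Card_order \<chi> \<and> \<chi> <o \<mu> \<longrightarrow>
        {\<epsilon>\<in>Field \<kappa>. \<not> (\<chi> <o lam \<epsilon> \<and> lam \<epsilon> \<le>o \<mu>)} \<in> Jbd \<kappa>)"

definition limit_of_measurables :: "'m rel \<Rightarrow> bool" where
  "limit_of_measurables \<mu> \<longleftrightarrow>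
     (\<forall>\<chi> :: 'm rel. Card_order \<chi> \<and> \<chi> <o \<mu> \<longrightarrow>
        (\<exists>\<nu> :: 'm rel. measurable_cardinal \<nu> \<and> \<chi> <o \<nu> \<and> \<nu> <o \<mu>))"

text \<open>
  The product of the sets \<open>A \<epsilon>\<close>, preordered by \<open>le \<epsilon>\<close>, is \<open>\<Upsilon>\<close>-directed modulo \<open>Jbd \<kappa>\<close>.
\<close>

definition product_directed ::
  "'u rel \<Rightarrow> 'k rel \<Rightarrow> ('k \<Rightarrow> 'b set) \<Rightarrow> ('k \<Rightarrow> 'b \<Rightarrow> 'b \<Rightarrow> bool) \<Rightarrow> bool" where
  "product_directed \<Upsilon> \<kappa> A le \<longleftrightarrow>
     (\<forall>\<F>. \<F> \<subseteq> Pi\<^sub>E (Field \<kappa>) A \<and> |\<F>| <o \<Upsilon> \<longrightarrow>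
        (\<exists>g \<in> Pi\<^sub>E (Field \<kappa>) A. \<forall>f\<in>\<F>. {\<epsilon>\<in>Field \<kappa>. \<not> le \<epsilon> (f \<epsilon>) (g \<epsilon>)} \<in> Jbd \<kappa>))"

end

(*
  Fix \<epsilon> and put \<lambda> = lam \<epsilon>. Diagonal intersections give a normal ultrafilter pseudo-intersections of
  any \<lambda> of its members. Since 2^\<lambda> = \<lambda>^+, the ultrafilter can be indexed injectively by \<lambda>^+, and for
  each \<alpha> < \<lambda>^+ the at most \<lambda> members of index \<le> \<alpha> have a pseudo-intersection C(\<alpha>) in it. Hence if g
  bounds the index functions of a family of sequences modulo bounded sets, then \<epsilon> \<mapsto> C(g \<epsilon>)
  bounds the family itself.
*)
theory Submission
  imports Defs
begin

lemma Jbd_subset: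
  assumes "X \<in> Jbd r" and "Y \<subseteq> X"
  shows "Y \<in> Jbd r"
  using assms unfolding Jbd_def by blast

text \<open>Enumerate \<open>S\<close> along \<open>Field r\<close> and take the diagonal
  intersection \<open>C\<close>. Any element of \<open>C\<close> strictly above the index of
  \<open>Y\<close> lies in \<open>Y\<close>, so that index bounds \<open>C - Y\<close>.\<close>

lemma normal_pseudo_intersection:
  assumes "Card_order r" and D: "normal_uniform_ultrafilter r D"
    and "S \<subseteq> D" and "|S| \<le>o r"
  shows "\<exists>C\<in>D. \<forall>X\<in>S. almost_subset r C X"
proof -
  have wo: "wo_rel r"
    using card_order_on_well_order_on[OF assms(1)] by (simp add: wo_rel_def)
  have top: "Field r \<in> D"
    using D by (simp add: normal_uniform_ultrafilter_def ultrafilter_on_def)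
  have "|S| \<le>o |Field r|"
    using assms(1,4) card_of_Field_ordIso ordIso_symmetric ordLeq_ordIso_trans by blast
  then obtain k where inj: "inj_on k S" and k: "k ` S \<subseteq> Field r"
    using card_of_ordLeq[of S "Field r"] by blast
  define X where "X i = (if i \<in> k ` S then inv_into S k i else Field r)" for i
  define C where "C = diagonal_intersection r X"
  have "X i \<in> D" for i
    using top \<open>S \<subseteq> D\<close> inv_into_into[of i k S] by (auto simp: X_def)
  then have "C \<in> D"
    using D by (simp add: C_def normal_uniform_ultrafilter_def)
  moreover have "almost_subset r C Y" if "Y \<in> S" for Y
  proof -
    have kY: "k Y \<in> Field r" and XkY: "X (k Y) = Y"
      using that k inj by (auto simp: X_def)
    have "(\<beta>, k Y) \<in> r" if "\<beta> \<in> C - Y" for \<beta>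
    proof -
      \<comment> \<open>If \<open>k Y\<close> were strictly below \<beta>, membership in
        \<open>C\<close> would put \<beta> into \<open>X (k Y) = Y\<close>. Totality of
        \<open>r\<close> then leaves only \<beta> at or below \<open>k Y\<close>.\<close>
      have "\<beta> \<in> Field r" "k Y \<notin> underS r \<beta>"
        using that XkY by (auto simp: C_def diagonal_intersection_def)
      then show ?thesis
        using wo_rel.TOTALS[OF wo] kY unfolding underS_def by blast
    qed
    moreover have "C \<subseteq> Field r"
      by (auto simp: C_def diagonal_intersection_def)
    ultimately show ?thesis
      using kY by (auto simp: almost_subset_def Jbd_def)
  qed
  ultimately show ?thesis by blast
qed

text \<open>Proper initial segments of a cardinal are strictly smaller than it, and being smaller
  than \<open>cardSuc r\<close> means having size at most \<open>r\<close>.\<close>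

lemma card_of_under_cardSuc:
  assumes "Card_order r" "cinfinite r" and "\<alpha> \<in> Field (cardSuc r)"
  shows "|under (cardSuc r) \<alpha>| \<le>o r"
proof -
  have co: "Card_order (cardSuc r)" and inf: "\<not> finite (Field (cardSuc r))"
    using assms by (auto simp: cinfinite_def cardSuc_Card_order cardSuc_finite)
  \<comment> \<open>\<open>card_of_underS\<close> measures strict segments only, so the closed
    segment up to \<alpha> is placed inside the strict one below a larger \<open>b\<close>. Such a
    \<open>b\<close> exists because an infinite cardinal has no last element.\<close>
  obtain b where b: "b \<in> Field (cardSuc r)" "\<alpha> \<noteq> b" "(\<alpha>, b) \<in> cardSuc r"
    using infinite_Card_order_limit[OF co inf assms(3)] by blast
  have wo: "wo_rel (cardSuc r)"
    using card_order_on_well_order_on[OF co] by (simp add: wo_rel_def)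
  have "under (cardSuc r) \<alpha> \<subseteq> underS (cardSuc r) b"
  proof
    fix x assume "x \<in> under (cardSuc r) \<alpha>"
    then have x: "(x, \<alpha>) \<in> cardSuc r"
      by (simp add: under_def)
    then have "(x, b) \<in> cardSuc r"
      using b(3) by (rule transD[OF wo_rel.TRANS[OF wo]])
    moreover have "x \<noteq> b"
      using x b(2,3) antisymD[OF wo_rel.ANTISYM[OF wo]] by blast
    ultimately show "x \<in> underS (cardSuc r) b"
      by (simp add: underS_def)
  qed
  then have "|under (cardSuc r) \<alpha>| <o cardSuc r"
    using card_of_underS[OF co b(1)] card_of_mono1 ordLeq_ordLess_trans by blast
  then show ?thesis
    using assms(1) by (simp add: cardSuc_ordLeq_ordLess card_of_Card_order)
qed

text \<open>The pair \<open>h\<close>, \<open>C\<close> is a Galois-Tukey connection between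
  \<open>D\<close> under reverse almost inclusion and \<open>cardSuc r\<close>: \<open>h\<close>
  encodes members as ordinals, and \<open>C\<close> decodes an upper bound of codes into an upper
  bound of the members. This is the form in which directedness can be transferred.\<close>

lemma normal_ultrafilter_indexed_pseudo_intersections:
  assumes "Card_order r" "cinfinite r" and "ctwo ^c r =o cardSuc r"
    and D: "normal_uniform_ultrafilter r D"
  shows "\<exists>h C. h ` D \<subseteq> Field (cardSuc r) \<and>
    (\<forall>\<alpha>\<in>Field (cardSuc r). C \<alpha> \<in> D \<and>
      (\<forall>X\<in>D. (h X, \<alpha>) \<in> cardSuc r \<longrightarrow> almost_subset r (C \<alpha>) X))"
proof -
  have "D \<subseteq> Pow (Field r)"
    using D by (simp add: normal_uniform_ultrafilter_def ultrafilter_on_def)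
  then have "|D| \<le>o |Pow (Field r)|"
    by (rule card_of_mono1)
  also have "|Pow (Field r)| =o ctwo ^c |Field r|"
    using card_of_Pow_Func[of "Field r"] by (simp add: cexp_def ctwo_def Field_card_of)
  also have "ctwo ^c |Field r| =o ctwo ^c r"
    by (rule cexp_cong2[OF card_of_Field_ordIso[OF assms(1)] Card_order_ctwo card_of_Card_order])
  also note assms(3)
  also have "cardSuc r =o |Field (cardSuc r)|"
    by (rule ordIso_symmetric[OF card_of_Field_ordIso[OF cardSuc_Card_order[OF assms(1)]]])
  finally have "|D| \<le>o |Field (cardSuc r)|" .
  then obtain h where inj: "inj_on h D" and h: "h ` D \<subseteq> Field (cardSuc r)"
    unfolding card_of_ordLeq[symmetric] by blast
  have "\<exists>C\<in>D. \<forall>X\<in>{X\<in>D. (h X, \<alpha>) \<in> cardSuc r}. almost_subset r C X"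
    if "\<alpha> \<in> Field (cardSuc r)" for \<alpha>
  proof (rule normal_pseudo_intersection[OF assms(1) D])
    \<comment> \<open>Injectivity of \<open>h\<close> embeds the members with code at most \<alpha>
      into the segment up to \<alpha>, so there are at most \<open>r\<close> of them.\<close>
    have "|{X\<in>D. (h X, \<alpha>) \<in> cardSuc r}| \<le>o |under (cardSuc r) \<alpha>|"
      using inj by (intro card_of_ordLeqI[of h]) (auto simp: under_def inj_on_def)
    then show "|{X\<in>D. (h X, \<alpha>) \<in> cardSuc r}| \<le>o r"
      using card_of_under_cardSuc[OF assms(1,2) that] by (rule ordLeq_transitive)
  qed blast
  then have "\<exists>C. \<forall>\<alpha>\<in>Field (cardSuc r). C \<alpha> \<in> D \<and>
      (\<forall>X\<in>D. (h X, \<alpha>) \<in> cardSuc r \<longrightarrow> almost_subset r (C \<alpha>) X)"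
    by (intro bchoice) blast
  with h show ?thesis by blast
qed

theorem theorem4p5:
  fixes \<mu> :: "'m rel" and \<kappa> :: "'k rel" and \<Upsilon> :: "'u rel"
    and lam :: "'k \<Rightarrow> 'a rel"
  assumes "singular_cardinal \<mu>"
    and "has_cofinality \<mu> \<kappa>"
    and "limit_of_measurables \<mu>"
    and "\<And>\<epsilon>. \<epsilon> \<in> Field \<kappa> \<Longrightarrow> measurable_cardinal (lam \<epsilon>)"
    and "tends_to_cardinal \<kappa> lam \<mu>"
    and "\<And>\<epsilon>. \<epsilon> \<in> Field \<kappa> \<Longrightarrow> ctwo ^c lam \<epsilon> =o cardSuc (lam \<epsilon>)"
    and "Card_order \<Upsilon>"
    and "cardSuc (cardSuc \<mu>) \<le>o \<Upsilon>"
    and "\<Upsilon> <o ctwo ^c \<mu>"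
    and "product_directed \<Upsilon> \<kappa> (\<lambda>\<epsilon>. Field (cardSuc (lam \<epsilon>)))
           (\<lambda>\<epsilon> \<alpha> \<beta>. (\<alpha>, \<beta>) \<in> cardSuc (lam \<epsilon>))"
  shows "\<forall>D. (\<forall>\<epsilon>\<in>Field \<kappa>. normal_uniform_ultrafilter (lam \<epsilon>) (D \<epsilon>)) \<longrightarrow>
           product_directed \<Upsilon> \<kappa> D (\<lambda>\<epsilon> C C'. almost_subset (lam \<epsilon>) C' C)"
proof (intro allI impI)
  fix D
  assume D: "\<forall>\<epsilon>\<in>Field \<kappa>. normal_uniform_ultrafilter (lam \<epsilon>) (D \<epsilon>)"
  have "\<forall>\<epsilon>\<in>Field \<kappa>. \<exists>h C. h ` D \<epsilon> \<subseteq> Field (cardSuc (lam \<epsilon>)) \<and>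
    (\<forall>\<alpha>\<in>Field (cardSuc (lam \<epsilon>)). C \<alpha> \<in> D \<epsilon> \<and>
      (\<forall>X\<in>D \<epsilon>. (h X, \<alpha>) \<in> cardSuc (lam \<epsilon>) \<longrightarrow> almost_subset (lam \<epsilon>) (C \<alpha>) X))"
  proof
    fix \<epsilon> assume \<epsilon>: "\<epsilon> \<in> Field \<kappa>"
    have co: "Card_order (lam \<epsilon>)" and "natLeq \<le>o lam \<epsilon>"
      using assms(4)[OF \<epsilon>] by (auto simp: measurable_cardinal_def ordLess_imp_ordLeq)
    then have "cinfinite (lam \<epsilon>)"
      using cinfinite_mono natLeq_cinfinite by blast
    with co show "\<exists>h C. h ` D \<epsilon> \<subseteq> Field (cardSuc (lam \<epsilon>)) \<and>
      (\<forall>\<alpha>\<in>Field (cardSuc (lam \<epsilon>)). C \<alpha> \<in> D \<epsilon> \<and>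
        (\<forall>X\<in>D \<epsilon>. (h X, \<alpha>) \<in> cardSuc (lam \<epsilon>) \<longrightarrow> almost_subset (lam \<epsilon>) (C \<alpha>) X))"
      using assms(6)[OF \<epsilon>] D[rule_format, OF \<epsilon>]
      by (rule normal_ultrafilter_indexed_pseudo_intersections)
  qed
  \<comment> \<open>Two rounds of choice, first for \<open>h\<close> and then for \<open>C\<close>,
    make the connection a function of the coordinate \<epsilon>.\<close>
  from bchoice[OF this] obtain h where "\<forall>\<epsilon>\<in>Field \<kappa>. \<exists>C. h \<epsilon> ` D \<epsilon> \<subseteq> Field (cardSuc (lam \<epsilon>)) \<and>
    (\<forall>\<alpha>\<in>Field (cardSuc (lam \<epsilon>)). C \<alpha> \<in> D \<epsilon> \<and>
      (\<forall>X\<in>D \<epsilon>. (h \<epsilon> X, \<alpha>) \<in> cardSuc (lam \<epsilon>) \<longrightarrow> almost_subset (lam \<epsilon>) (C \<alpha>) X))" ..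
  from bchoice[OF this] obtain C where hC: "\<forall>\<epsilon>\<in>Field \<kappa>. h \<epsilon> ` D \<epsilon> \<subseteq> Field (cardSuc (lam \<epsilon>)) \<and>
    (\<forall>\<alpha>\<in>Field (cardSuc (lam \<epsilon>)). C \<epsilon> \<alpha> \<in> D \<epsilon> \<and>
      (\<forall>X\<in>D \<epsilon>. (h \<epsilon> X, \<alpha>) \<in> cardSuc (lam \<epsilon>) \<longrightarrow> almost_subset (lam \<epsilon>) (C \<epsilon> \<alpha>) X))" ..
  have h: "h \<epsilon> X \<in> Field (cardSuc (lam \<epsilon>))" if "\<epsilon> \<in> Field \<kappa>" "X \<in> D \<epsilon>" for \<epsilon> X
    using bspec[OF hC that(1)] that(2) by (simp add: image_subset_iff)
  have C: "C \<epsilon> \<alpha> \<in> D \<epsilon>"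
    if "\<epsilon> \<in> Field \<kappa>" "\<alpha> \<in> Field (cardSuc (lam \<epsilon>))" for \<epsilon> \<alpha>
    using bspec[OF hC that(1)] that(2) by simp
  have almost: "almost_subset (lam \<epsilon>) (C \<epsilon> \<alpha>) X"
    if "\<epsilon> \<in> Field \<kappa>" "\<alpha> \<in> Field (cardSuc (lam \<epsilon>))" "X \<in> D \<epsilon>" "(h \<epsilon> X, \<alpha>) \<in> cardSuc (lam \<epsilon>)"
    for \<epsilon> \<alpha> X
    using bspec[OF hC that(1)] that(2-4) by simp
  show "product_directed \<Upsilon> \<kappa> D (\<lambda>\<epsilon> C C'. almost_subset (lam \<epsilon>) C' C)"
    unfolding product_directed_def
  proof (intro allI impI)
    fix \<F>
    assume "\<F> \<subseteq> Pi\<^sub>E (Field \<kappa>) D \<and> |\<F>| <o \<Upsilon>"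
    then have \<F>: "\<F> \<subseteq> Pi\<^sub>E (Field \<kappa>) D" "|\<F>| <o \<Upsilon>"
      by simp_all
    have mem: "f \<epsilon> \<in> D \<epsilon>" if "f \<in> \<F>" "\<epsilon> \<in> Field \<kappa>" for f \<epsilon>
      using \<F>(1) that by (meson PiE_mem subsetD)
    \<comment> \<open>\<open>H f\<close> is the sequence of codes of \<open>f\<close>, restricted to
      \<open>Field \<kappa>\<close> because members of \<open>Pi\<^sub>E\<close> must be
      extensional.\<close>
    define H where "H f = (\<lambda>\<epsilon>\<in>Field \<kappa>. h \<epsilon> (f \<epsilon>))" for f
    have "H ` \<F> \<subseteq> (\<Pi>\<^sub>E \<epsilon>\<in>Field \<kappa>. Field (cardSuc (lam \<epsilon>)))"
      using h mem by (simp add: H_def image_subset_iff PiE_iff)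
    moreover have "|H ` \<F>| <o \<Upsilon>"
      using card_of_image \<F>(2) by (rule ordLeq_ordLess_trans)
    ultimately have "\<exists>g\<in>(\<Pi>\<^sub>E \<epsilon>\<in>Field \<kappa>. Field (cardSuc (lam \<epsilon>))).
      \<forall>f\<in>H ` \<F>. {\<epsilon>\<in>Field \<kappa>. (f \<epsilon>, g \<epsilon>) \<notin> cardSuc (lam \<epsilon>)} \<in> Jbd \<kappa>"
      by (intro mp[OF spec[OF assms(10)[unfolded product_directed_def]]] conjI)
    then obtain g where g: "g \<in> (\<Pi>\<^sub>E \<epsilon>\<in>Field \<kappa>. Field (cardSuc (lam \<epsilon>)))"
      and bound: "\<forall>f\<in>H ` \<F>. {\<epsilon>\<in>Field \<kappa>. (f \<epsilon>, g \<epsilon>) \<notin> cardSuc (lam \<epsilon>)} \<in> Jbd \<kappa>" ..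
    show "\<exists>G\<in>Pi\<^sub>E (Field \<kappa>) D. \<forall>f\<in>\<F>.
        {\<epsilon>\<in>Field \<kappa>. \<not> almost_subset (lam \<epsilon>) (G \<epsilon>) (f \<epsilon>)} \<in> Jbd \<kappa>"
    \<comment> \<open>The bound \<open>g\<close> on the codes is decoded coordinate by
      coordinate.\<close>
    proof (rule bexI[where x = "\<lambda>\<epsilon>\<in>Field \<kappa>. C \<epsilon> (g \<epsilon>)"], rule ballI)
      fix f assume f: "f \<in> \<F>"
      \<comment> \<open>Wherever the code of \<open>f \<epsilon>\<close> is at most
        \<open>g \<epsilon>\<close>, the set \<open>C \<epsilon> (g \<epsilon>)\<close> is almost
        contained in \<open>f \<epsilon>\<close>. So the exceptional set lies inside the bounded one
        already obtained for \<open>H f\<close>.\<close>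
      show "{\<epsilon>\<in>Field \<kappa>. \<not> almost_subset (lam \<epsilon>) ((\<lambda>\<epsilon>\<in>Field \<kappa>. C \<epsilon> (g \<epsilon>)) \<epsilon>) (f \<epsilon>)} \<in> Jbd \<kappa>"
        by (rule Jbd_subset[OF bspec[OF bound imageI[OF f]]])
          (use almost[OF _ PiE_mem[OF g] mem[OF f]] in \<open>auto simp: H_def\<close>)
    next
      show "(\<lambda>\<epsilon>\<in>Field \<kappa>. C \<epsilon> (g \<epsilon>)) \<in> Pi\<^sub>E (Field \<kappa>) D"
        using C PiE_mem[OF g] by (simp add: PiE_iff)
    qed
  qed
qed

end
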